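(* Let $\mathfrak{f}=\mathfrak{u}+\overline{\mathfrak{v}}\in\mathcal{KH}^{0}(k,\gamma)$, where $k$ is a positive integer, $0\le\gamma<1$, $\mathfrak{u}(z)=z+\sum_{m=2}^\infty u_m z^m$ and $\mathfrak{v}(z)=\sum_{m=2}^\infty v_m z^m$. Then for $m\ge 2$, $$|u_m|+|v_m|\le \gamma+m(1-\gamma).$$ Every one of these results is sharp, and all the equalities hold for the function $\mathfrak{f}(z)=z+[\gamma+m(1-\gamma)]z^m$.
   Context: $\mathbb{E}=\{z\in\mathbb{C}:|z|<1\}$. $\mathcal{SH}^0$ is the class of univalent, sense-preserving harmonic functions $\mathfrak{f}=\mathfrak{u}+\overline{\mathfrak{v}}$ on $\mathbb{E}$, where $\mathfrak{u}(z)=z+\sum_{m=2}^\infty u_m z^m$ and $\mathfrak{v}(z)=\sum_{m=2}^\infty v_m z^m$ are analytic in $\mathbb{E}$. For $0\le\beta<1$, $\mathcal{S}^*(\beta)$ is the class of analytic functions $\phi$ on $\mathbb{E}$ with $\phi(0)=0$, $\phi'(0)=1$ that are starlike of order $\beta$, i.e. $\mathrm{Re}\{z\phi'(z)/\phi(z)\}>\beta$ in $\mathbb{E}$. For a positive integer $k$ and $0\le\gamma<1$, $\mathcal{KH}^0(k,\gamma)$ is defined as the collection of functions $\mathfrak{f}=\mathfrak{u}+\overline{\mathfrak{v}}\in\mathcal{SH}^0$ that satisfy, for $z\in\mathbb{E}$, $$\mathrm{Re}\left\{\frac{z^k\mathfrak{u}'(z)}{\phi_k(z)}-\gamma\right\}>\left|\frac{z^k\mathfrak{v}'(z)}{\phi_k(z)}\right|,$$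 where $\phi_k(z)=\prod_{v=0}^{k-1}\mu^{-v}\phi(\mu^v z)$ with $\mu=e^{2\pi i/k}$, and $\phi(z)=z+\sum_{m=2}^\infty c_m z^m$ is an analytic function belonging to $\mathcal{S}^*\left(\frac{k-1}{k}\right)$.
   Formalization: Sharpness is shown only for k=1 (it fails for k≥2), by the function z+Σ_{m≥2}[γ+m(1-γ)]z^m; the printed z+[γ+m(1-γ)]z^m is not in the class (its derivative vanishes in the disk), so only its coefficient equality is stated. *)

theory Defs
  imports "HOL-Complex_Analysis.Complex_Analysis"
begin

abbreviation unit_disk :: "complex set" where
  "unit_disk \<equiv> ball 0 1"

text \<open>Analyticity of \<open>u\<close> and \<open>v\<close> on the disk is contained in the convergence of their power
  series there. The values of \<open>a\<close> and \<open>b\<close> at 0 and 1 are irrelevant.\<close>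

definition harmonic_expansion ::
  "(complex \<Rightarrow> complex) \<Rightarrow> (complex \<Rightarrow> complex) \<Rightarrow> (complex \<Rightarrow> complex) \<Rightarrow>
   (nat \<Rightarrow> complex) \<Rightarrow> (nat \<Rightarrow> complex) \<Rightarrow> bool" where
  "harmonic_expansion f u v a b \<longleftrightarrow>
     (\<forall>z\<in>unit_disk. f z = u z + cnj (v z)) \<and>
     (\<forall>z\<in>unit_disk. (\<lambda>n. a (n + 2) * z ^ (n + 2)) sums (u z - z)) \<and>
     (\<forall>z\<in>unit_disk. (\<lambda>n. b (n + 2) * z ^ (n + 2)) sums v z)"

text \<open>Sense-preserving means that the Jacobian \<open>\<bar>u'\<bar>\<^sup>2 - \<bar>v'\<bar>\<^sup>2\<close> of \<open>f\<close> is positive.\<close>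

definition SH0 :: "(complex \<Rightarrow> complex) set" where
  "SH0 = {f. inj_on f unit_disk \<and>
     (\<exists>u v a b. harmonic_expansion f u v a b \<and>
        (\<forall>z\<in>unit_disk. (cmod (deriv u z))\<^sup>2 - (cmod (deriv v z))\<^sup>2 > 0))}"

text \<open>The quotient \<open>z \<phi>'(z) / \<phi>(z)\<close> has a removable singularity with value 1 at 0,
  where the inequality is automatic because \<open>\<beta> < 1\<close>; the origin must be left out because
  the formal quotient is \<open>0 / 0 = 0\<close> there. For \<open>\<beta> \<ge> 0\<close> the
  inequality rules out zeros of \<open>\<phi>\<close> away from the origin, since \<open>x / 0 = 0\<close>.\<close>

definition starlike_of_order :: "real \<Rightarrow> (complex \<Rightarrow> complex) set" where
  "starlike_of_order \<beta> = {\<phi>. \<phi> holomorphic_on unit_disk \<and> \<phi> 0 = 0 \<and> deriv \<phi> 0 = 1 \<and>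
     (\<forall>z\<in>unit_disk - {0}. Re (z * deriv \<phi> z / \<phi> z) > \<beta>)}"

definition root_mu :: "nat \<Rightarrow> complex" where
  "root_mu k = exp (2 * of_real pi * \<i> / of_nat k)"

definition sym_prod :: "nat \<Rightarrow> (complex \<Rightarrow> complex) \<Rightarrow> complex \<Rightarrow> complex" where
  "sym_prod k \<phi> z = (\<Prod>j<k. root_mu k powi (- int j) * \<phi> (root_mu k ^ j * z))"

text \<open>The origin is again a removable singularity: there the two quotients take the values 1
  and 0, and the inequality becomes \<open>1 - \<gamma> > 0\<close>.\<close>

definition KH0 :: "nat \<Rightarrow> real \<Rightarrow> (complex \<Rightarrow> complex) set" where
  "KH0 k \<gamma> = {f \<in> SH0. \<exists>u v a b. harmonic_expansion f u v a b \<and>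
     (\<exists>\<phi> \<in> starlike_of_order ((real k - 1) / real k).
        \<forall>z\<in>unit_disk - {0}.
          Re (z ^ k * deriv u z / sym_prod k \<phi> z - of_real \<gamma>)
            > cmod (z ^ k * deriv v z / sym_prod k \<phi> z))}"

end

theory Submission
  imports Defs
begin

text \<open>
  The bound comes from comparing the derivatives of \<open>u\<close> and \<open>v\<close> with a starlike function.
  Write \<open>\<phi> z = z * h z\<close> and let \<open>g z\<close> be the product of the \<open>h (\<mu> ^ j * z)\<close>. The factors
  \<open>\<mu> ^ (- j)\<close> in \<open>\<phi>\<^sub>k\<close> cancel exactly, so \<open>\<phi>\<^sub>k z = z ^ k * g z\<close>. Starlikeness of
  order \<open>(k - 1) / k\<close> says \<open>Re (z h'/h) > - 1 / k\<close>; logarithmic derivatives of the \<open>k\<close> factors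
  add up, whence \<open>Re (1 + z g'/g) > 0\<close>. Hence \<open>z * g z\<close> is starlike of order 0, whatever \<open>k\<close>
  is, and the defining inequality becomes \<open>Re (p - \<gamma>) > |q|\<close> for the holomorphic functions
  \<open>p = u' / g\<close> and \<open>q = v' / g\<close>.

  Both ingredients are then controlled by Caratheodory's inequality
  (\<open>caratheodory_coeff_bound\<close>): a function with nonnegative real part has Taylor coefficients at
  most twice its real part at 0. Applied to \<open>1 + z g'/g\<close> it yields
  \<open>|g\<^sub>n| \<le> n + 1\<close> (\<open>starlike_coeff_bound\<close>); applied to \<open>p + \<epsilon> q - \<gamma>\<close> with a unimodular
  \<open>\<epsilon>\<close> that aligns the two \<open>n\<close>-th coefficients it yields
  \<open>|p\<^sub>n| + |q\<^sub>n| \<le> 2 (1 - \<gamma>)\<close> (\<open>dominated_pair_coeff_bound\<close>). Multiplying out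
  \<open>u' = g p\<close> and \<open>v' = g q\<close>, with \<open>p\<^sub>0 = 1\<close> and \<open>q\<^sub>0 = 0\<close>, gives
  \<open>m (|u\<^sub>m| + |v\<^sub>m|) \<le> m + (1 - \<gamma>) m (m - 1)\<close>, which is the claim multiplied by \<open>m\<close>.

  Membership in the class only provides some decomposition \<open>u + cnj v\<close>, so the bound must be
  carried over to an arbitrary expansion of the same function. This is possible because the
  Fourier coefficients of a harmonic function on a circle determine both power series
  (\<open>harmonic_expansion_unique\<close>).

  For sharpness, all inequalities become equalities for \<open>k = 1\<close>, the Koebe function
  \<open>\<phi> z = z / (1 - z)\<^sup>2\<close>, \<open>v = 0\<close> and \<open>p = \<gamma> + (1 - \<gamma>) (1 + z) / (1 - z)\<close>. Integrating
  \<open>u' = p \<phi> / z\<close> gives \<open>\<gamma> z / (1 - z) + (1 - \<gamma>) z / (1 - z)\<^sup>2\<close>, with coefficients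
  \<open>\<gamma> + m (1 - \<gamma>)\<close>. The polynomial \<open>z + (\<gamma> + m (1 - \<gamma>)) z ^ m\<close> carries the bound as its single
  nontrivial coefficient, so for it the equality of index \<open>m\<close> is immediate.
\<close>

section \<open>Fourier integrals of Taylor coefficients\<close>

lemma cis_multiple_turn: "cis (2 * pi * real n * t) = cis (2 * pi * t) ^ n"
  by (subst Complex.DeMoivre) (simp add: mult_ac)

text \<open>This is Cauchy's formula for the \<open>n\<close>-th derivative, with the circle of radius \<open>r\<close> parametrised by
  the unit interval.\<close>

lemma taylor_coeff_fourier_integral:
  assumes f: "f holomorphic_on unit_disk" and r: "0 < r" "r < 1"
  shows "((\<lambda>t. f (of_real r * cis (2 * pi * t)) * cis (- (2 * pi * real n * t)))
           has_integral (fps_nth (fps_expansion f 0) n * of_real r ^ n)) {0..1}"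
proof -
  have "continuous_on (cball 0 r) f" "f holomorphic_on ball 0 r"
    using f r by (auto intro!: holomorphic_on_imp_continuous_on intro: holomorphic_on_subset)
  then have "((\<lambda>u. f u / (u - 0) ^ Suc n) has_contour_integral
        (2 * pi * \<i>) / fact n * (deriv ^^ n) f 0) (circlepath 0 r)"
    using r by (intro Cauchy_has_contour_integral_higher_derivative_circlepath) auto
  then have "((\<lambda>t. of_real r ^ n / (2 * pi * \<i>) *
        (f (circlepath 0 r t) / (circlepath 0 r t) ^ Suc n *
          vector_derivative (circlepath 0 r) (at t))) has_integral
        (of_real r ^ n / (2 * pi * \<i>)) * ((2 * pi * \<i>) / fact n * (deriv ^^ n) f 0)) {0..1}"
    unfolding has_contour_integral by (intro has_integral_mult_right) simp
  moreover have "of_real r ^ n / (2 * pi * \<i>) *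
        (f (circlepath 0 r t) / (circlepath 0 r t) ^ Suc n *
          vector_derivative (circlepath 0 r) (at t)) =
        f (of_real r * cis (2 * pi * t)) * cis (- (2 * pi * real n * t))" for t
  proof -
    define c where "c = cis (2 * pi * t)"
    have c: "circlepath 0 r t = of_real r * c"
      by (simp add: circlepath c_def cis_conv_exp mult_ac)
    have c': "vector_derivative (circlepath 0 r) (at t) = 2 * pi * \<i> * r * c"
      by (simp add: vector_derivative_circlepath c_def cis_conv_exp mult_ac)
    have "cis (- (2 * pi * real n * t)) = inverse (c ^ n)"
      unfolding c_def cis_multiple_turn[symmetric] by simp
    moreover have "c \<noteq> 0" by (simp add: c_def)
    ultimately show ?thesis
      using r unfolding c c' c_def[symmetric] by (simp add: field_simps)
  qed
  ultimately show ?thesis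
    by (simp add: fps_expansion_def field_simps)
qed

text \<open>Cauchy's formula at the origin for \<open>z ^ n * f z\<close>, which vanishes there; on the circle the extra
  factor is the power \<open>r ^ n\<close> times the exponential in the integrand.\<close>

lemma taylor_negative_fourier_integral:
  assumes f: "f holomorphic_on unit_disk" and r: "0 < r" "r < 1" and n: "n \<ge> 1"
  shows "((\<lambda>t. f (of_real r * cis (2 * pi * t)) * cis (2 * pi * real n * t))
           has_integral 0) {0..1}"
proof -
  have "(\<lambda>z. f z * z ^ n) holomorphic_on unit_disk"
    by (intro holomorphic_intros f)
  from taylor_coeff_fourier_integral[OF this r, of 0] n
  have "((\<lambda>t. f (of_real r * cis (2 * pi * t)) * (of_real r * cis (2 * pi * t)) ^ n)
           has_integral 0) {0..1}"
    by (simp add: fps_expansion_def power_0_left)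
  then have "((\<lambda>t. inverse (of_real r ^ n) *
      (f (of_real r * cis (2 * pi * t)) * (of_real r * cis (2 * pi * t)) ^ n))
           has_integral inverse (of_real r ^ n) * 0) {0..1}"
    by (rule has_integral_mult_right)
  moreover have "inverse (of_real r ^ n) *
      (f (of_real r * cis (2 * pi * t)) * (of_real r * cis (2 * pi * t)) ^ n) =
      f (of_real r * cis (2 * pi * t)) * cis (2 * pi * real n * t)" for t
    using r by (simp add: power_mult_distrib cis_multiple_turn)
  ultimately show ?thesis by simp
qed

text \<open>An antiholomorphic summand is invisible to the positive frequencies: conjugation turns its
  frequency \<open>n\<close> integral into a frequency \<open>- n\<close> integral of a holomorphic function. This drives
  both Caratheodory's inequality (with \<open>g = f\<close>) and the uniqueness of harmonic expansions.\<close>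

lemma harmonic_coeff_fourier_integral:
  assumes f: "f holomorphic_on unit_disk" and g: "g holomorphic_on unit_disk"
    and r: "0 < r" "r < 1" and n: "n \<ge> 1"
  shows "((\<lambda>t. (f (of_real r * cis (2 * pi * t)) + cnj (g (of_real r * cis (2 * pi * t))))
              * cis (- (2 * pi * real n * t)))
           has_integral (fps_nth (fps_expansion f 0) n * of_real r ^ n)) {0..1}"
proof -
  have "((cnj \<circ> (\<lambda>t. g (of_real r * cis (2 * pi * t)) * cis (2 * pi * real n * t)))
           has_integral cnj 0) {0..1}"
    unfolding has_integral_cnj by (rule taylor_negative_fourier_integral[OF g r n])
  from has_integral_add[OF taylor_coeff_fourier_integral[OF f r] this]
  show ?thesis by (simp add: o_def cis_cnj ring_distribs)
qed

text \<open>The \<open>n\<close>-th coefficient is a Fourier coefficient of \<open>P + cnj P = 2 Re P\<close>, hence bounded by the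
  integral of this nonnegative function, and that integral is given by the mean value property.\<close>

theorem caratheodory_coeff_bound:
  assumes P: "P holomorphic_on unit_disk" and Re: "\<And>z. z \<in> unit_disk \<Longrightarrow> Re (P z) \<ge> 0"
    and n: "n \<ge> 1"
  shows "cmod (fps_nth (fps_expansion P 0) n) \<le> 2 * Re (P 0)"
proof -
  \<comment> \<open>The estimate on the circle of radius \<open>r\<close> carries a factor \<open>r ^ n\<close>, removed below by \<open>r \<rightarrow> 1\<close>.\<close>
  have bound: "cmod (fps_nth (fps_expansion P 0) n) * r ^ n \<le> 2 * Re (P 0)"
    if r: "0 < r" "r < 1" for r
  proof -
    have 1: "((\<lambda>t. 2 * P (of_real r * cis (2 * pi * t))) has_integral (2 * P 0)) {0..1}"
      using taylor_coeff_fourier_integral[OF P r, of 0]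
      by (intro has_integral_mult_right) (simp add: fps_expansion_def)
    have "cmod (fps_nth (fps_expansion P 0) n * of_real r ^ n) \<le> (2 * P 0) \<bullet> 1"
    proof (rule has_integral_norm_bound_integral_component
            [OF harmonic_coeff_fourier_integral[OF P P r n] 1])
      fix t :: real
      let ?w = "of_real r * cis (2 * pi * t)"
      have "?w \<in> unit_disk" using r by (simp add: norm_mult)
      from Re[OF this] have "cmod (P ?w + cnj (P ?w)) = 2 * Re (P ?w)"
        by (simp add: complex_add_cnj)
      then show "cmod ((P ?w + cnj (P ?w)) * cis (- (2 * pi * real n * t))) \<le> (2 * P ?w) \<bullet> 1"
        by (simp add: norm_mult inner_complex_def)
    qed
    then show ?thesis using r by (simp add: norm_mult norm_power inner_complex_def)
  qed
  have "((\<lambda>r. cmod (fps_nth (fps_expansion P 0) n) * r ^ n) \<longlongrightarrow>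
          cmod (fps_nth (fps_expansion P 0) n) * 1 ^ n) (at_left 1)"
    by (intro tendsto_intros)
  moreover have "\<forall>\<^sub>F r in at_left (1 :: real). r \<in> {0<..<1}"
    by (rule eventually_at_left_real) simp
  then have "\<forall>\<^sub>F r in at_left 1. cmod (fps_nth (fps_expansion P 0) n) * r ^ n \<le> 2 * Re (P 0)"
    by eventually_elim (use bound in auto)
  ultimately show ?thesis
    using tendsto_upperbound trivial_limit_at_left_real by fastforce
qed

section \<open>Coefficient bounds\<close>

lemma holomorphic_disk_has_fps_expansion:
  "f holomorphic_on unit_disk \<Longrightarrow> f has_fps_expansion fps_expansion f 0"
  by (rule has_fps_expansion_fps_expansion[of unit_disk]) auto

lemma fps_expansion_mult_disk:
  assumes "f holomorphic_on unit_disk" "g holomorphic_on unit_disk"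
    and eq: "\<And>z. z \<in> unit_disk \<Longrightarrow> h z = f z * g z"
  shows "fps_expansion h 0 = fps_expansion f 0 * fps_expansion g 0"
proof -
  have "fps_expansion h 0 = fps_expansion (\<lambda>z. f z * g z) 0"
    by (rule fps_expansion_cong)
      (use eq in \<open>auto simp: eventually_nhds intro!: exI[of _ unit_disk]\<close>)
  also have "\<dots> = fps_expansion f 0 * fps_expansion g 0"
    by (intro fps_expansion_eqI has_fps_expansion_mult holomorphic_disk_has_fps_expansion assms)
  finally show ?thesis .
qed

lemma fps_expansion_deriv_disk:
  "f holomorphic_on unit_disk \<Longrightarrow> fps_expansion (deriv f) 0 = fps_deriv (fps_expansion f 0)"
  by (intro fps_expansion_eqI has_fps_expansion_deriv holomorphic_disk_has_fps_expansion)

lemma sum_Suc_lessThan_real: "(\<Sum>i<n. real (Suc i)) = real n * real (Suc n) / 2"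
  by (induction n) (auto simp: field_simps)

text \<open>The hypotheses say that \<open>z * g z\<close> is starlike. With \<open>P = 1 + z g'/g\<close>, comparing coefficients in
  \<open>g P = z g' + g\<close> expresses \<open>n g\<^sub>n\<close> by the earlier \<open>g\<^sub>i\<close> and the coefficients of \<open>P\<close>, each of
  modulus at most 2; so \<open>n |g\<^sub>n| \<le> 2 (1 + \<dots> + n) = n (n + 1)\<close> by induction.\<close>

theorem starlike_coeff_bound:
  assumes g: "g holomorphic_on unit_disk" and g0: "g 0 = 1"
    and nz: "\<And>z. z \<in> unit_disk \<Longrightarrow> g z \<noteq> 0"
    and Re: "\<And>z. z \<in> unit_disk \<Longrightarrow> Re (1 + z * deriv g z / g z) \<ge> 0"
  shows "cmod (fps_nth (fps_expansion g 0) n) \<le> real (Suc n)"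
proof -
  define P where "P = (\<lambda>z. 1 + z * deriv g z / g z)"
  define G where "G = fps_nth (fps_expansion g 0)"
  define c where "c = fps_nth (fps_expansion P 0)"
  have P: "P holomorphic_on unit_disk"
    unfolding P_def using nz by (intro holomorphic_intros g holomorphic_deriv) auto
  have c: "cmod (c n) \<le> 2" if "n \<ge> 1" for n
    using caratheodory_coeff_bound[OF P _ that] Re by (simp add: P_def c_def)
  have c0: "c 0 = 1" by (simp add: c_def fps_expansion_def P_def)
  have hol': "deriv g holomorphic_on unit_disk"
    by (intro holomorphic_deriv g) auto
  have X: "fps_expansion (\<lambda>z. z) 0 = fps_X"
    by (intro fps_expansion_eqI has_fps_expansion_fps_X)
  have "fps_expansion (\<lambda>z. z * deriv g z + g z) 0 =
          fps_X * fps_deriv (fps_expansion g 0) + fps_expansion g 0"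
    by (intro fps_expansion_eqI fps_expansion_intros holomorphic_disk_has_fps_expansion g)
  moreover have "fps_expansion (\<lambda>z. z * deriv g z + g z) 0 = fps_expansion g 0 * fps_expansion P 0"
    by (rule fps_expansion_mult_disk[OF g P]) (use nz in \<open>auto simp: P_def field_simps\<close>)
  ultimately have eq: "fps_expansion g 0 * fps_expansion P 0 =
          fps_X * fps_deriv (fps_expansion g 0) + fps_expansion g 0" by simp
  have rec: "of_nat n * G n = (\<Sum>i<n. G i * c (n - i))" for n
  proof -
    have "(\<Sum>i=0..n. G i * c (n - i)) = fps_nth (fps_expansion g 0 * fps_expansion P 0) n"
      by (simp add: fps_mult_nth G_def c_def)
    also have "\<dots> = of_nat n * G n + G n"
      unfolding eq by (cases n) (simp_all add: G_def)
    finally have "(\<Sum>i=0..n. G i * c (n - i)) = of_nat n * G n + G n" .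
    moreover have "{0..n} = insert n {..<n}" by auto
    ultimately show ?thesis by (simp add: c0)
  qed
  show ?thesis unfolding G_def[symmetric]
  proof (induction n rule: less_induct)
    case (less n)
    show ?case
    proof (cases "n = 0")
      case True
      then show ?thesis by (simp add: G_def fps_expansion_def g0)
    next
      case False
      have "real n * cmod (G n) = cmod (\<Sum>i<n. G i * c (n - i))"
        by (simp add: rec[symmetric] norm_mult)
      also have "\<dots> \<le> (\<Sum>i<n. real (Suc i) * 2)"
        by (rule sum_norm_le)
          (auto simp: norm_mult simp del: of_nat_Suc intro!: mult_mono less c)
      also have "\<dots> = real n * real (Suc n)"
        by (simp only: sum_distrib_right[symmetric] sum_Suc_lessThan_real)
      finally show ?thesis using False by simp
    qed
  qed
qed

lemma exists_aligning_rotation: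
  "\<exists>\<epsilon>. cmod \<epsilon> = 1 \<and> cmod (a + \<epsilon> * b) = cmod a + cmod b"
proof (intro exI conjI)
  let ?e = "cis (Arg a - Arg b)"
  have a: "a = of_real (cmod a) * cis (Arg a)" and b: "b = of_real (cmod b) * cis (Arg b)"
    using rcis_cmod_Arg[of a] rcis_cmod_Arg[of b] by (simp_all add: rcis_def)
  have "?e * b = of_real (cmod b) * cis (Arg a)"
    by (subst b) (simp add: mult.left_commute cis_mult)
  then have "a + ?e * b = of_real (cmod a + cmod b) * cis (Arg a)"
    using a by (metis distrib_right of_real_add)
  then show "cmod (a + ?e * b) = cmod a + cmod b"
    by (simp only: norm_mult norm_of_real norm_cis) simp
qed simp

text \<open>For unimodular \<open>\<epsilon>\<close> the function \<open>p + \<epsilon> q - \<gamma>\<close> has nonnegative real part and the value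
  \<open>1 - \<gamma>\<close> at 0. Choosing \<open>\<epsilon>\<close> so that the two \<open>n\<close>-th coefficients point in the same direction,
  Caratheodory's inequality bounds the sum of their moduli.\<close>

lemma dominated_pair_coeff_bound:
  assumes p: "p holomorphic_on unit_disk" and q: "q holomorphic_on unit_disk"
    and p0: "p 0 = 1" and q0: "q 0 = 0"
    and dom: "\<And>z. z \<in> unit_disk \<Longrightarrow> cmod (q z) \<le> Re (p z) - \<gamma>" and n: "n \<ge> 1"
  shows "cmod (fps_nth (fps_expansion p 0) n) + cmod (fps_nth (fps_expansion q 0) n) \<le> 2 * (1 - \<gamma>)"
proof -
  obtain \<epsilon> where \<epsilon>: "cmod \<epsilon> = 1"
    "cmod (fps_nth (fps_expansion p 0) n + \<epsilon> * fps_nth (fps_expansion q 0) n) =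
      cmod (fps_nth (fps_expansion p 0) n) + cmod (fps_nth (fps_expansion q 0) n)"
    using exists_aligning_rotation by blast
  define P where "P = (\<lambda>z. p z + \<epsilon> * q z - of_real \<gamma>)"
  have "fps_expansion P 0 = fps_expansion p 0 + fps_const \<epsilon> * fps_expansion q 0 - fps_const (of_real \<gamma>)"
    unfolding P_def
    by (intro fps_expansion_eqI fps_expansion_intros holomorphic_disk_has_fps_expansion p q)
  then have "fps_nth (fps_expansion P 0) n =
      fps_nth (fps_expansion p 0) n + \<epsilon> * fps_nth (fps_expansion q 0) n"
    using n by simp
  moreover have "P holomorphic_on unit_disk"
    unfolding P_def by (intro holomorphic_intros p q)
  moreover have "Re (P z) \<ge> 0" if "z \<in> unit_disk" for z
  proof -
    have "- Re (\<epsilon> * q z) \<le> cmod (\<epsilon> * q z)"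
      using abs_Re_le_cmod[of "\<epsilon> * q z"] by linarith
    also have "\<dots> = cmod (q z)" by (simp add: norm_mult \<epsilon>)
    finally show ?thesis using dom[OF that] by (simp add: P_def)
  qed
  ultimately show ?thesis
    using caratheodory_coeff_bound[of P n] n \<epsilon>(2) by (simp add: P_def p0 q0)
qed

text \<open>The factorisations \<open>u' = g p\<close> and \<open>v' = g q\<close> turn the coefficients into convolutions. The term
  with index \<open>i = N\<close> pairs \<open>g\<^sub>N\<close> with \<open>p 0 = 1\<close> and \<open>q 0 = 0\<close>; the others contribute at most
  \<open>(i + 1) * 2 (1 - \<gamma>)\<close> each.\<close>

theorem close_to_convex_coeff_bound:
  assumes u: "u holomorphic_on unit_disk" and v: "v holomorphic_on unit_disk"
    and u1: "deriv u 0 = 1" and v1: "deriv v 0 = 0" and "\<gamma> \<le> 1"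
    and g: "g holomorphic_on unit_disk" and g0: "g 0 = 1"
    and nz: "\<And>z. z \<in> unit_disk \<Longrightarrow> g z \<noteq> 0"
    and star: "\<And>z. z \<in> unit_disk \<Longrightarrow> Re (1 + z * deriv g z / g z) \<ge> 0"
    and dom: "\<And>z. z \<in> unit_disk \<Longrightarrow> cmod (deriv v z / g z) \<le> Re (deriv u z / g z) - \<gamma>"
  shows "cmod (fps_nth (fps_expansion u 0) (Suc N)) + cmod (fps_nth (fps_expansion v 0) (Suc N))
           \<le> \<gamma> + real (Suc N) * (1 - \<gamma>)"
proof -
  define p where "p = (\<lambda>z. deriv u z / g z)"
  define q where "q = (\<lambda>z. deriv v z / g z)"
  define G where "G = fps_nth (fps_expansion g 0)"
  define a where "a = fps_nth (fps_expansion p 0)"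
  define b where "b = fps_nth (fps_expansion q 0)"
  have p: "p holomorphic_on unit_disk" and q: "q holomorphic_on unit_disk"
    unfolding p_def q_def using nz by (auto intro!: holomorphic_intros g u v holomorphic_deriv)
  have ab: "cmod (a n) + cmod (b n) \<le> 2 * (1 - \<gamma>)" if "n \<ge> 1" for n
    unfolding a_def b_def
    by (rule dominated_pair_coeff_bound[OF p q _ _ _ that])
       (use dom in \<open>auto simp: p_def q_def u1 v1 g0\<close>)
  have ab0: "a 0 = 1" "b 0 = 0"
    by (simp_all add: a_def b_def fps_expansion_def p_def q_def u1 v1 g0)
  have G: "cmod (G n) \<le> real (Suc n)" for n
    unfolding G_def by (rule starlike_coeff_bound[OF g g0 nz star])
  have "fps_deriv (fps_expansion u 0) = fps_expansion g 0 * fps_expansion p 0"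
    unfolding fps_expansion_deriv_disk[OF u, symmetric]
    by (rule fps_expansion_mult_disk[OF g p]) (use nz in \<open>auto simp: p_def\<close>)
  from arg_cong[OF this, of "\<lambda>F. fps_nth F N"]
  have U: "of_nat (Suc N) * fps_nth (fps_expansion u 0) (Suc N) = (\<Sum>i=0..N. G i * a (N - i))"
    by (simp add: fps_mult_nth G_def a_def)
  have "fps_deriv (fps_expansion v 0) = fps_expansion g 0 * fps_expansion q 0"
    unfolding fps_expansion_deriv_disk[OF v, symmetric]
    by (rule fps_expansion_mult_disk[OF g q]) (use nz in \<open>auto simp: q_def\<close>)
  from arg_cong[OF this, of "\<lambda>F. fps_nth F N"]
  have V: "of_nat (Suc N) * fps_nth (fps_expansion v 0) (Suc N) = (\<Sum>i=0..N. G i * b (N - i))"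
    by (simp add: fps_mult_nth G_def b_def)
  have "real (Suc N) * (cmod (fps_nth (fps_expansion u 0) (Suc N))
            + cmod (fps_nth (fps_expansion v 0) (Suc N)))
      = cmod (\<Sum>i=0..N. G i * a (N - i)) + cmod (\<Sum>i=0..N. G i * b (N - i))"
    by (simp only: U[symmetric] V[symmetric] norm_mult norm_of_nat distrib_left)
  also have "\<dots> \<le> (\<Sum>i=0..N. cmod (G i * a (N - i))) + (\<Sum>i=0..N. cmod (G i * b (N - i)))"
    by (intro add_mono norm_sum)
  also have "\<dots> = (\<Sum>i=0..N. cmod (G i) * (cmod (a (N - i)) + cmod (b (N - i))))"
    by (simp add: sum.distrib norm_mult distrib_left)
  also have "{0..N} = insert N {..<N}" by auto
  also have "(\<Sum>i\<in>insert N {..<N}. cmod (G i) * (cmod (a (N - i)) + cmod (b (N - i))))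
      = cmod (G N) + (\<Sum>i<N. cmod (G i) * (cmod (a (N - i)) + cmod (b (N - i))))"
    by (simp add: ab0)
  also have "\<dots> \<le> real (Suc N) + (\<Sum>i<N. real (Suc i) * (2 * (1 - \<gamma>)))"
    by (intro add_mono sum_mono mult_mono G ab) auto
  also have "\<dots> = real (Suc N) * (\<gamma> + real (Suc N) * (1 - \<gamma>))"
    by (simp only: sum_distrib_right[symmetric] sum_Suc_lessThan_real) (simp add: field_simps)
  finally show ?thesis
    by (rule mult_left_le_imp_le) simp
qed

section \<open>The symmetrised starlike function\<close>

text \<open>Dividing out the zero at the origin makes every later quotient holomorphic on the whole disk.
  Since \<open>z \<phi>'/\<phi> = 1 + z h'/h\<close>, the order of starlikeness drops by 1.\<close>

lemma starlike_quotient: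
  assumes "\<phi> \<in> starlike_of_order \<beta>" and "\<beta> \<ge> 0"
  obtains h where "h holomorphic_on unit_disk" "h 0 = 1"
    "\<And>z. z \<in> unit_disk \<Longrightarrow> h z \<noteq> 0"
    "\<And>z. z \<in> unit_disk \<Longrightarrow> \<phi> z = z * h z"
    "\<And>z. z \<in> unit_disk - {0} \<Longrightarrow> Re (z * deriv h z / h z) > \<beta> - 1"
proof -
  have hol: "\<phi> holomorphic_on unit_disk" and \<phi>0: "\<phi> 0 = 0" and \<phi>1: "deriv \<phi> 0 = 1"
    and Re: "\<And>z. z \<in> unit_disk - {0} \<Longrightarrow> Re (z * deriv \<phi> z / \<phi> z) > \<beta>"
    using assms(1) by (auto simp: starlike_of_order_def)
  define h where "h = (\<lambda>z. if z = 0 then deriv \<phi> 0 else (\<phi> z - \<phi> 0) / (z - 0))"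
  have h: "h holomorphic_on unit_disk"
    unfolding h_def by (rule pole_lemma_open[OF hol]) auto
  have h0: "h 0 = 1" by (simp add: h_def \<phi>1)
  have eq: "\<phi> z = z * h z" for z by (simp add: h_def \<phi>0)
  have nz: "h z \<noteq> 0" if "z \<in> unit_disk" for z
  proof (cases "z = 0")
    case False
    with Re[of z] that assms(2) have "\<phi> z \<noteq> 0" by auto
    then show ?thesis by (simp add: eq)
  qed (simp add: h0)
  have "Re (z * deriv h z / h z) > \<beta> - 1" if z: "z \<in> unit_disk - {0}" for z
  proof -
    have "((\<lambda>z. z * h z) has_field_derivative h z + z * deriv h z) (at z)"
      using z by (auto intro!: derivative_eq_intros holomorphic_derivI[OF h])
    then have "deriv \<phi> z = h z + z * deriv h z"
      by (simp add: DERIV_imp_deriv flip: eq)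
    then have "z * deriv \<phi> z / \<phi> z = 1 + z * deriv h z / h z"
      using z nz[of z] by (simp add: eq field_simps)
    then show ?thesis using Re[OF z] by simp
  qed
  with h h0 nz eq show thesis using that by blast
qed

lemma norm_root_mu [simp]: "cmod (root_mu k) = 1"
  by (simp add: root_mu_def)

text \<open>The \<open>j\<close>-th factor of the symmetrised product is \<open>z * h (\<mu> ^ j * z)\<close>. Each of the \<open>k\<close> summands
  of \<open>z g'/g\<close> has real part above \<open>(k - 1) / k - 1 = - 1 / k\<close>: this is where the order
  \<open>(k - 1) / k\<close> comes from.\<close>

lemma sym_prod_starlike_quotient:
  assumes k: "k \<ge> 1" and \<phi>: "\<phi> \<in> starlike_of_order ((real k - 1) / real k)"
  obtains g where "g holomorphic_on unit_disk" "g 0 = 1"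
    "\<And>z. z \<in> unit_disk \<Longrightarrow> g z \<noteq> 0"
    "\<And>z. z \<in> unit_disk \<Longrightarrow> sym_prod k \<phi> z = z ^ k * g z"
    "\<And>z. z \<in> unit_disk \<Longrightarrow> Re (1 + z * deriv g z / g z) \<ge> 0"
proof -
  have "(real k - 1) / real k \<ge> 0" using k by simp
  from starlike_quotient[OF \<phi> this] obtain h where
    h: "h holomorphic_on unit_disk" and h0: "h 0 = 1"
    and nz: "\<And>z. z \<in> unit_disk \<Longrightarrow> h z \<noteq> 0"
    and eq: "\<And>z. z \<in> unit_disk \<Longrightarrow> \<phi> z = z * h z"
    and Re: "\<And>z. z \<in> unit_disk - {0} \<Longrightarrow> Re (z * deriv h z / h z) > (real k - 1) / real k - 1"
    by metis
  define \<mu> where "\<mu> = root_mu k"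
  have \<mu>[simp]: "cmod \<mu> = 1" "\<mu> \<noteq> 0"
    using norm_root_mu[of k] by (auto simp: \<mu>_def simp del: norm_root_mu)
  have disk: "\<mu> ^ j * z \<in> unit_disk" if "z \<in> unit_disk" for j z
    using that by (simp add: norm_mult norm_power)
  define g where "g = (\<lambda>z. \<Prod>j<k. h (\<mu> ^ j * z))"
  have der: "(g has_field_derivative
      g z * (\<Sum>j<k. (deriv h (\<mu> ^ j * z) * \<mu> ^ j) / h (\<mu> ^ j * z))) (at z)"
    if z: "z \<in> unit_disk" for z
    unfolding g_def
  proof (rule has_field_derivative_prod')
    fix j
    show "h (\<mu> ^ j * z) \<noteq> 0" by (intro nz disk z)
    have "(h has_field_derivative deriv h (\<mu> ^ j * z)) (at (\<mu> ^ j * z))"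
      by (rule holomorphic_derivI[OF h]) (use disk z in auto)
    moreover have "((\<lambda>z. \<mu> ^ j * z) has_field_derivative \<mu> ^ j) (at z)"
      by (auto intro!: derivative_eq_intros)
    ultimately show "((\<lambda>z. h (\<mu> ^ j * z)) has_field_derivative deriv h (\<mu> ^ j * z) * \<mu> ^ j) (at z)"
      by (rule DERIV_chain2)
  qed
  have "g holomorphic_on unit_disk"
    unfolding holomorphic_on_open[OF open_ball] using der by blast
  moreover have "g 0 = 1" by (simp add: g_def h0)
  moreover have gnz: "g z \<noteq> 0" if "z \<in> unit_disk" for z
    unfolding g_def using nz disk that by simp
  moreover have "sym_prod k \<phi> z = z ^ k * g z" if z: "z \<in> unit_disk" for z
  proof -
    have "\<mu> powi (- int j) * \<phi> (\<mu> ^ j * z) = z * h (\<mu> ^ j * z)" for j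
      using eq[OF disk[OF z]] by (simp add: power_int_minus)
    then show ?thesis
      by (simp add: sym_prod_def \<mu>_def[symmetric] g_def prod.distrib)
  qed
  moreover have "Re (1 + z * deriv g z / g z) \<ge> 0" if z: "z \<in> unit_disk" for z
  proof (cases "z = 0")
    case False
    have "z * deriv g z / g z =
        (\<Sum>j<k. (\<mu> ^ j * z) * deriv h (\<mu> ^ j * z) / h (\<mu> ^ j * z))"
    proof -
      have "z * deriv g z / g z = z * (\<Sum>j<k. (deriv h (\<mu> ^ j * z) * \<mu> ^ j) / h (\<mu> ^ j * z))"
        using gnz[OF z] by (simp add: DERIV_imp_deriv[OF der[OF z]])
      then show ?thesis by (simp add: sum_distrib_left mult_ac)
    qed
    then have "Re (z * deriv g z / g z) =
        (\<Sum>j<k. Re ((\<mu> ^ j * z) * deriv h (\<mu> ^ j * z) / h (\<mu> ^ j * z)))"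
      by simp
    also have "\<dots> \<ge> (\<Sum>j<k. (real k - 1) / real k - 1)"
      by (intro sum_mono less_imp_le Re) (use disk z False in auto)
    finally show ?thesis using k by (simp add: field_simps)
  qed simp
  ultimately show thesis using that by blast
qed

section \<open>Harmonic expansions\<close>

lemma harmonic_expansion_holomorphic:
  assumes "harmonic_expansion f u v a b"
  shows "u holomorphic_on unit_disk" "v holomorphic_on unit_disk"
    "fps_expansion u 0 = Abs_fps (\<lambda>n. if n = 0 then 0 else if n = 1 then 1 else a n)"
    "fps_expansion v 0 = Abs_fps (\<lambda>n. if n < 2 then 0 else b n)"
proof -
  let ?A = "Abs_fps (\<lambda>n. if n = 0 then 0 else if n = 1 then 1 else a n)"
  let ?B = "Abs_fps (\<lambda>n. if n < 2 then 0 else b n)"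
  have u: "(\<lambda>n. fps_nth ?A n * z ^ n) sums u z" if "z \<in> unit_disk" for z
  proof -
    have "(\<lambda>n. fps_nth ?A (n + 2) * z ^ (n + 2)) sums (u z - z)"
      using assms that by (simp add: harmonic_expansion_def)
    then show ?thesis
      by (subst (asm) sums_iff_shift) (simp add: numeral_2_eq_2)
  qed
  have v: "(\<lambda>n. fps_nth ?B n * z ^ n) sums v z" if "z \<in> unit_disk" for z
  proof -
    have "(\<lambda>n. fps_nth ?B (n + 2) * z ^ (n + 2)) sums v z"
      using assms that by (simp add: harmonic_expansion_def)
    then show ?thesis
      by (subst (asm) sums_iff_shift) (simp add: numeral_2_eq_2)
  qed
  show "u holomorphic_on unit_disk"
    by (rule power_series_holomorphic) (use u in simp)
  show "v holomorphic_on unit_disk"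
    by (rule power_series_holomorphic) (use v in simp)
  show "fps_expansion u 0 = ?A"
    by (intro fps_expansion_eqI has_fps_expansionI)
      (use u in \<open>auto simp: eventually_nhds intro!: exI[of _ unit_disk]\<close>)
  show "fps_expansion v 0 = ?B"
    by (intro fps_expansion_eqI has_fps_expansionI)
      (use v in \<open>auto simp: eventually_nhds intro!: exI[of _ unit_disk]\<close>)
qed

text \<open>Both sides are the same Fourier coefficient of the common harmonic function on the circle of
  radius 1/2.\<close>

lemma harmonic_coeff_unique:
  assumes hol: "u holomorphic_on unit_disk" "v holomorphic_on unit_disk"
    "u' holomorphic_on unit_disk" "v' holomorphic_on unit_disk"
    and eq: "\<And>z. z \<in> unit_disk \<Longrightarrow> u z + cnj (v z) = u' z + cnj (v' z)" and n: "n \<ge> 1"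
  shows "fps_nth (fps_expansion u 0) n = fps_nth (fps_expansion u' 0) n"
proof -
  let ?w = "\<lambda>t. of_real (1/2) * cis (2 * pi * t)"
  have r: "0 < (1/2 :: real)" "(1/2 :: real) < 1" by auto
  have "?w t \<in> unit_disk" for t by (simp add: norm_mult)
  then have "(\<lambda>t. (u (?w t) + cnj (v (?w t))) * cis (- (2 * pi * real n * t))) =
      (\<lambda>t. (u' (?w t) + cnj (v' (?w t))) * cis (- (2 * pi * real n * t)))"
    using eq by (intro ext) metis
  from harmonic_coeff_fourier_integral[OF hol(1,2) r n, unfolded this]
    harmonic_coeff_fourier_integral[OF hol(3,4) r n]
  have "fps_nth (fps_expansion u 0) n * of_real (1/2) ^ n =
      fps_nth (fps_expansion u' 0) n * of_real (1/2) ^ n"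
    by (rule has_integral_unique)
  then show ?thesis by simp
qed

lemma harmonic_expansion_unique:
  assumes e: "harmonic_expansion f u v a b" and e': "harmonic_expansion f u' v' a' b'"
    and m: "m \<ge> 2"
  shows "a m = a' m" "b m = b' m"
proof -
  note h = harmonic_expansion_holomorphic[OF e]
  note h' = harmonic_expansion_holomorphic[OF e']
  \<comment> \<open>Conjugating the function exchanges the two parts, so one lemma serves both sequences.\<close>
  have eq: "u z + cnj (v z) = u' z + cnj (v' z)" if "z \<in> unit_disk" for z
    using e e' that by (metis harmonic_expansion_def)
  then have eq': "v z + cnj (u z) = v' z + cnj (u' z)" if "z \<in> unit_disk" for z
    using arg_cong[OF eq[OF that], of cnj] by (simp add: add.commute)
  show "a m = a' m"
    using harmonic_coeff_unique[OF h(1,2) h'(1,2) eq, of m] m h(3) h'(3) by simp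
  show "b m = b' m"
    using harmonic_coeff_unique[OF h(2,1) h'(2,1) eq', of m] m h(4) h'(4) by simp
qed

theorem KH0_coeff_bound:
  assumes k: "k \<ge> 1" and \<gamma>: "\<gamma> < 1" and f: "f \<in> KH0 k \<gamma>"
    and e: "harmonic_expansion f u v a b" and m: "m \<ge> 2"
  shows "cmod (a m) + cmod (b m) \<le> \<gamma> + real m * (1 - \<gamma>)"
proof -
  from f obtain u' v' a' b' \<phi> where e': "harmonic_expansion f u' v' a' b'"
    and \<phi>: "\<phi> \<in> starlike_of_order ((real k - 1) / real k)"
    and dom: "\<And>z. z \<in> unit_disk - {0} \<Longrightarrow>
          Re (z ^ k * deriv u' z / sym_prod k \<phi> z - of_real \<gamma>)
            > cmod (z ^ k * deriv v' z / sym_prod k \<phi> z)"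
    unfolding KH0_def by blast
  from sym_prod_starlike_quotient[OF k \<phi>] obtain g where
    g: "g holomorphic_on unit_disk" "g 0 = 1"
    "\<And>z. z \<in> unit_disk \<Longrightarrow> g z \<noteq> 0"
    and prod: "\<And>z. z \<in> unit_disk \<Longrightarrow> sym_prod k \<phi> z = z ^ k * g z"
    and star: "\<And>z. z \<in> unit_disk \<Longrightarrow> Re (1 + z * deriv g z / g z) \<ge> 0"
    by metis
  note h = harmonic_expansion_holomorphic[OF e']
  have d: "deriv u' 0 = 1" "deriv v' 0 = 0"
    using arg_cong[OF h(3), of "\<lambda>F. fps_nth F 1"] arg_cong[OF h(4), of "\<lambda>F. fps_nth F 1"]
    by (simp_all add: fps_expansion_def)
  have "cmod (deriv v' z / g z) \<le> Re (deriv u' z / g z) - \<gamma>" if z: "z \<in> unit_disk" for z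
  proof (cases "z = 0")
    case True
    then show ?thesis using \<gamma> by (simp add: d g(2))
  next
    case False
    then show ?thesis using dom[of z] z by (simp add: prod)
  qed
  from close_to_convex_coeff_bound[OF h(1,2) d _ g star this, of "m - 1"] \<gamma> m
  have "cmod (fps_nth (fps_expansion u' 0) m) + cmod (fps_nth (fps_expansion v' 0) m)
      \<le> \<gamma> + real m * (1 - \<gamma>)" by simp
  then show ?thesis
    using m h(3,4) harmonic_expansion_unique[OF e e' m] by simp
qed

section \<open>The extremal function\<close>

definition extremal_map :: "real \<Rightarrow> complex \<Rightarrow> complex" where
  "extremal_map \<gamma> z = of_real \<gamma> * (z / (1 - z)) + of_real (1 - \<gamma>) * (z / (1 - z)\<^sup>2)"

lemma unit_disk_one_minus_nz: "z \<in> unit_disk \<Longrightarrow> 1 - z \<noteq> 0"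
  by auto

text \<open>The map \<open>z \<mapsto> 1 / (1 - z)\<close> carries the disk onto the half plane \<open>Re w > 1 / 2\<close>.\<close>

lemma Re_inverse_one_minus:
  assumes "z \<in> unit_disk"
  shows "Re (1 / (1 - z)) > 1 / 2"
proof -
  have "cmod z ^ 2 < 1" using assms by (simp add: abs_square_less_1)
  then have less: "(Re z)\<^sup>2 + (Im z)\<^sup>2 < 1" by (simp add: cmod_power2)
  have "1 - Re z > 0" using assms abs_Re_le_cmod[of z] by simp
  then have "(1 - Re z)\<^sup>2 + (Im z)\<^sup>2 > 0" by (simp add: sum_power2_gt_zero_iff)
  then show ?thesis
    using less by (simp add: Re_divide power2_eq_square field_simps)
qed

lemma Re_cayley_pos:
  assumes "z \<in> unit_disk"
  shows "Re ((1 + z) / (1 - z)) > 0"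
proof -
  have "(1 + z) / (1 - z) = 1 / (1 - z) + 1 / (1 - z) - 1"
    using unit_disk_one_minus_nz[OF assms] by (simp add: field_simps)
  then have "Re ((1 + z) / (1 - z)) = Re (1 / (1 - z)) + Re (1 / (1 - z)) - 1"
    by (simp only: minus_complex.sel plus_complex.sel one_complex.sel)
  then show ?thesis using Re_inverse_one_minus[OF assms] by linarith
qed

lemma Re_affine: "Re (of_real a + of_real b * w) = a + b * Re w"
  by simp

text \<open>In the variable \<open>c = 1 / (1 - z)\<close> the function is a quadratic polynomial. Its difference at
  \<open>c\<close> and \<open>d\<close> is \<open>c - d\<close> times \<open>2 \<gamma> - 1 + (1 - \<gamma>) (c + d)\<close>, whose real part exceeds
  \<open>2 \<gamma> - 1 + (1 - \<gamma>) = \<gamma> \<ge> 0\<close> because \<open>Re (c + d) > 1\<close>.\<close>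

lemma extremal_map_inj:
  assumes "0 \<le> \<gamma>" "\<gamma> < 1"
  shows "inj_on (extremal_map \<gamma>) unit_disk"
proof (rule inj_onI)
  fix z w assume z: "z \<in> unit_disk" and w: "w \<in> unit_disk"
    and eq: "extremal_map \<gamma> z = extremal_map \<gamma> w"
  let ?c = "\<lambda>z. 1 / (1 - z) :: complex"
  have *: "extremal_map \<gamma> z = (?c z - 1) * (of_real \<gamma> + of_real (1 - \<gamma>) * ?c z)"
    if "z \<in> unit_disk" for z
  proof -
    have 1: "z / (1 - z) = ?c z - 1"
      using unit_disk_one_minus_nz[OF that] by (simp add: field_simps)
    have "z / (1 - z)\<^sup>2 = z / (1 - z) * ?c z"
      by (simp add: power2_eq_square)
    then have 2: "z / (1 - z)\<^sup>2 = (?c z - 1) * ?c z"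
      by (simp only: 1)
    show ?thesis unfolding extremal_map_def 1 2 by (simp only: algebra_simps)
  qed
  have "extremal_map \<gamma> z - extremal_map \<gamma> w =
      (?c z - ?c w) * (of_real (2 * \<gamma> - 1) + of_real (1 - \<gamma>) * (?c z + ?c w))"
    unfolding *[OF z] *[OF w] of_real_diff of_real_mult of_real_1 of_real_numeral by algebra
  moreover have "Re (of_real (2 * \<gamma> - 1) + of_real (1 - \<gamma>) * (?c z + ?c w)) > 0"
  proof -
    have "Re (?c z + ?c w) > 1"
      using Re_inverse_one_minus[OF z] Re_inverse_one_minus[OF w] by simp
    with assms have "(1 - \<gamma>) * Re (?c z + ?c w) > 1 - \<gamma>" by simp
    then show ?thesis unfolding Re_affine using assms(1) by linarith
  qed
  ultimately have "?c z = ?c w"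
    using eq by (metis cancel_comm_monoid_add_class.diff_cancel eq_iff_diff_eq_0 less_irrefl
        mult_eq_0_iff zero_complex.sel(1))
  then show "z = w"
    using unit_disk_one_minus_nz[OF z] unit_disk_one_minus_nz[OF w] by (simp add: field_simps)
qed

lemma koebe_has_field_derivative:
  fixes z :: complex
  assumes "z \<in> unit_disk"
  shows "((\<lambda>z. z / (1 - z)\<^sup>2) has_field_derivative (1 + z) / (1 - z) ^ 3) (at z)"
proof -
  define y where "y = 1 - z"
  have y: "y \<noteq> 0" "1 - z = y" "z = 1 - y"
    using unit_disk_one_minus_nz[OF assms] by (auto simp: y_def)
  have "((\<lambda>z. (1 - z)\<^sup>2) has_field_derivative - (2 * y)) (at z)"
    by (auto intro!: derivative_eq_intros simp: y)
  from DERIV_divide[OF DERIV_ident this]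
  have "((\<lambda>z. z / (1 - z)\<^sup>2) has_field_derivative
      (1 * y\<^sup>2 - z * (- (2 * y))) / (y\<^sup>2 * y\<^sup>2)) (at z)"
    using y(1) unfolding y(2) by simp
  moreover have "(1 * y\<^sup>2 - z * (- (2 * y))) / (y\<^sup>2 * y\<^sup>2) = (1 + z) / y ^ 3"
    using y(1) unfolding y(3) by (simp add: field_simps power2_eq_square power3_eq_cube)
  ultimately show ?thesis unfolding y(2) by simp
qed

lemma deriv_extremal_map:
  assumes z: "z \<in> unit_disk"
  shows "deriv (extremal_map \<gamma>) z =
     (of_real \<gamma> + of_real (1 - \<gamma>) * ((1 + z) / (1 - z))) / (1 - z)\<^sup>2"
proof (rule DERIV_imp_deriv)
  have "((\<lambda>z. z / (1 - z)) has_field_derivative 1 / (1 - z)\<^sup>2) (at z)"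
    using unit_disk_one_minus_nz[OF z]
    by (auto intro!: derivative_eq_intros simp: power2_eq_square)
  then have "(extremal_map \<gamma> has_field_derivative
      of_real \<gamma> * (1 / (1 - z)\<^sup>2) + of_real (1 - \<gamma>) * ((1 + z) / (1 - z) ^ 3)) (at z)"
    unfolding extremal_map_def[abs_def]
    by (intro DERIV_add DERIV_cmult koebe_has_field_derivative z)
  moreover have "a * (1 / y\<^sup>2) + b * (x / y ^ 3) = (a + b * (x / y)) / y\<^sup>2" for a b x y :: complex
    by (simp add: add_divide_distrib power2_eq_square power3_eq_cube mult_ac)
  ultimately show "(extremal_map \<gamma> has_field_derivative
     (of_real \<gamma> + of_real (1 - \<gamma>) * ((1 + z) / (1 - z))) / (1 - z)\<^sup>2) (at z)"
    by (simp only:)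
qed

lemma extremal_map_sums:
  assumes z: "z \<in> unit_disk"
  shows "(\<lambda>n. of_real (\<gamma> + real (n + 2) * (1 - \<gamma>)) * z ^ (n + 2)) sums (extremal_map \<gamma> z - z)"
proof -
  let ?c = "\<lambda>n. of_real (\<gamma> + real (n + 1) * (1 - \<gamma>)) :: complex"
  have "cmod z < 1" using z by simp
  then have "(\<lambda>n. z * (of_real \<gamma> * z ^ n + of_real (1 - \<gamma>) * (of_nat (Suc n) * z ^ n)))
      sums (z * (of_real \<gamma> * (1 / (1 - z)) + of_real (1 - \<gamma>) * (1 / (1 - z)\<^sup>2)))"
    by (intro sums_mult sums_add geometric_sums geometric_deriv_sums)
  moreover have "z * (of_real \<gamma> * z ^ n + of_real (1 - \<gamma>) * (of_nat (Suc n) * z ^ n)) =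
      ?c n * z ^ (n + 1)" for n
    by (simp add: algebra_simps)
  moreover have "z * (of_real \<gamma> * (1 / (1 - z)) + of_real (1 - \<gamma>) * (1 / (1 - z)\<^sup>2)) =
      extremal_map \<gamma> z"
    by (simp add: extremal_map_def algebra_simps)
  ultimately have "(\<lambda>n. ?c n * z ^ (n + 1)) sums extremal_map \<gamma> z" by (simp only:)
  then have "(\<lambda>n. ?c (n + 1) * z ^ (n + 1 + 1)) sums (extremal_map \<gamma> z - z)"
    by (subst sums_iff_shift) simp
  then show ?thesis by (simp add: add.assoc)
qed

lemma extremal_map_expansion:
  "harmonic_expansion (extremal_map \<gamma>) (extremal_map \<gamma>) (\<lambda>_. 0)
     (\<lambda>n. of_real (\<gamma> + real n * (1 - \<gamma>))) (\<lambda>_. 0)"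
  unfolding harmonic_expansion_def
  using extremal_map_sums[of _ \<gamma>] by auto

lemma koebe_starlike: "(\<lambda>z. z / (1 - z)\<^sup>2) \<in> starlike_of_order 0"
proof -
  have "z * ((1 + z) / (1 - z) ^ 3) / (z / (1 - z)\<^sup>2) = (1 + z) / (1 - z)"
    if "z \<in> unit_disk - {0}" for z :: complex
    using unit_disk_one_minus_nz[of z] that
    by (simp add: divide_simps power2_eq_square power3_eq_cube)
  moreover have "(\<lambda>z. z / (1 - z)\<^sup>2) holomorphic_on unit_disk"
    by (intro holomorphic_intros) auto
  ultimately show ?thesis
    using Re_cayley_pos by (simp add: starlike_of_order_def DERIV_imp_deriv[OF koebe_has_field_derivative])
qed

text \<open>With the Koebe function as comparison function and \<open>v = 0\<close>, the quotient is
  \<open>\<gamma> + (1 - \<gamma>) (1 + z) / (1 - z)\<close>, whose real part exceeds \<open>\<gamma>\<close>. The same positivity shows that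
  the derivative has no zeros, which is the sense-preserving condition for an analytic map.\<close>

lemma extremal_map_in_KH0:
  assumes "0 \<le> \<gamma>" "\<gamma> < 1"
  shows "extremal_map \<gamma> \<in> KH0 1 \<gamma>"
proof -
  have pos: "Re (of_real \<gamma> + of_real (1 - \<gamma>) * ((1 + z) / (1 - z))) > \<gamma>"
    if "z \<in> unit_disk" for z
    unfolding Re_affine using Re_cayley_pos[OF that] assms by simp
  have "deriv (extremal_map \<gamma>) z \<noteq> 0" if "z \<in> unit_disk" for z
  proof -
    have "of_real \<gamma> + of_real (1 - \<gamma>) * ((1 + z) / (1 - z)) \<noteq> 0"
      using pos[OF that] assms by (metis leD zero_complex.sel(1))
    then show ?thesis
      using unit_disk_one_minus_nz[OF that] deriv_extremal_map[OF that] by simp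
  qed
  then have SH: "extremal_map \<gamma> \<in> SH0"
    unfolding SH0_def using extremal_map_inj[OF assms] extremal_map_expansion[of \<gamma>]
    by fastforce
  have *: "z ^ 1 * deriv (extremal_map \<gamma>) z / sym_prod 1 (\<lambda>z. z / (1 - z)\<^sup>2) z =
      of_real \<gamma> + of_real (1 - \<gamma>) * ((1 + z) / (1 - z))" if "z \<in> unit_disk - {0}" for z
    using that unit_disk_one_minus_nz[of z]
    by (simp add: sym_prod_def deriv_extremal_map)
  have "Re (z ^ 1 * deriv (extremal_map \<gamma>) z / sym_prod 1 (\<lambda>z. z / (1 - z)\<^sup>2) z - of_real \<gamma>)
      > cmod (z ^ 1 * deriv (\<lambda>_. 0) z / sym_prod 1 (\<lambda>z. z / (1 - z)\<^sup>2) z)"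
    if "z \<in> unit_disk - {0}" for z
    unfolding *[OF that] using pos[of z] that by simp
  moreover have "(\<lambda>z. z / (1 - z)\<^sup>2) \<in> starlike_of_order ((real 1 - 1) / real 1)"
    using koebe_starlike by simp
  ultimately show ?thesis
    unfolding KH0_def using SH extremal_map_expansion[of \<gamma>] by blast
qed

lemma monomial_expansion:
  assumes "m \<ge> 2"
  shows "harmonic_expansion (\<lambda>z. z + c * z ^ m) (\<lambda>z. z + c * z ^ m) (\<lambda>_. 0)
           (\<lambda>n. if n = m then c else 0) (\<lambda>_. 0)"
proof -
  have "(\<lambda>n. (if n + 2 = m then c else 0) * z ^ (n + 2)) sums (c * z ^ m)" for z :: complex
  proof -
    have "(\<lambda>n. (if n = m - 2 then c * z ^ m else 0)) sums (c * z ^ m)"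
      by (rule sums_single)
    moreover have "(\<lambda>n. (if n = m - 2 then c * z ^ m else 0)) =
        (\<lambda>n. (if n + 2 = m then c else 0) * z ^ (n + 2))"
      using assms by (intro ext) auto
    ultimately show ?thesis by (simp only:)
  qed
  then show ?thesis by (simp add: harmonic_expansion_def)
qed

theorem theorem3p6:
  fixes k :: nat and \<gamma> :: real
  assumes "k \<ge> 1" and "0 \<le> \<gamma>" and "\<gamma> < 1"
  shows
    "(\<forall>f u v a b. f \<in> KH0 k \<gamma> \<and> harmonic_expansion f u v a b \<longrightarrow>
        (\<forall>m\<ge>2. cmod (a m) + cmod (b m) \<le> \<gamma> + real m * (1 - \<gamma>))) \<and>
     (\<exists>F u v a b. F \<in> KH0 1 \<gamma> \<and> harmonic_expansion F u v a b \<and>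
        (\<forall>z\<in>unit_disk. (\<lambda>n. of_real (\<gamma> + real (n + 2) * (1 - \<gamma>)) * z ^ (n + 2)) sums (F z - z)) \<and>
        (\<forall>m\<ge>2. cmod (a m) + cmod (b m) = \<gamma> + real m * (1 - \<gamma>))) \<and>
     (\<forall>m\<ge>2. \<exists>u v a b.
        harmonic_expansion (\<lambda>z. z + of_real (\<gamma> + real m * (1 - \<gamma>)) * z ^ m) u v a b \<and>
        cmod (a m) + cmod (b m) = \<gamma> + real m * (1 - \<gamma>))"
proof (intro conjI)
  have norm: "cmod (of_real (\<gamma> + real m * (1 - \<gamma>))) = \<gamma> + real m * (1 - \<gamma>)" for m
    unfolding norm_of_real using assms by simp
  show "\<forall>f u v a b. f \<in> KH0 k \<gamma> \<and> harmonic_expansion f u v a b \<longrightarrow>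
        (\<forall>m\<ge>2. cmod (a m) + cmod (b m) \<le> \<gamma> + real m * (1 - \<gamma>))"
    using KH0_coeff_bound assms by blast
  show "\<exists>F u v a b. F \<in> KH0 1 \<gamma> \<and> harmonic_expansion F u v a b \<and>
        (\<forall>z\<in>unit_disk. (\<lambda>n. of_real (\<gamma> + real (n + 2) * (1 - \<gamma>)) * z ^ (n + 2)) sums (F z - z)) \<and>
        (\<forall>m\<ge>2. cmod (a m) + cmod (b m) = \<gamma> + real m * (1 - \<gamma>))"
  proof (intro exI conjI ballI allI impI)
    show "extremal_map \<gamma> \<in> KH0 1 \<gamma>" by (rule extremal_map_in_KH0) fact+
    show "cmod (of_real (\<gamma> + real m * (1 - \<gamma>))) + cmod 0 = \<gamma> + real m * (1 - \<gamma>)" for m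
      by (simp only: norm) simp
  qed (rule extremal_map_expansion extremal_map_sums, assumption?)+
  show "\<forall>m\<ge>2. \<exists>u v a b.
        harmonic_expansion (\<lambda>z. z + of_real (\<gamma> + real m * (1 - \<gamma>)) * z ^ m) u v a b \<and>
        cmod (a m) + cmod (b m) = \<gamma> + real m * (1 - \<gamma>)"
  proof (intro allI impI exI conjI)
    fix m :: nat assume m: "m \<ge> 2"
    show "harmonic_expansion (\<lambda>z. z + of_real (\<gamma> + real m * (1 - \<gamma>)) * z ^ m)
        (\<lambda>z. z + of_real (\<gamma> + real m * (1 - \<gamma>)) * z ^ m) (\<lambda>_. 0)
        (\<lambda>n. if n = m then of_real (\<gamma> + real m * (1 - \<gamma>)) else 0) (\<lambda>_. 0)"
      by (rule monomial_expansion[OF m])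
    show "cmod (if m = m then of_real (\<gamma> + real m * (1 - \<gamma>)) else 0) + cmod 0
        = \<gamma> + real m * (1 - \<gamma>)"
      by (simp only: simp_thms if_True norm norm_zero add_0_right)
  qed
qed

end
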